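(* Let $n\ge1$, $q\in[1,\infty]$, $s\in\mathbb{R}$, let $\mathbb{B}^n$ be the unit ball of $\mathbb{R}^n$, let $q_n=\frac{2(n+1)}{n-1}$ (with $q_1=\infty$), and $$s_{n,q}=\max\left\{n\left(\tfrac12-\tfrac1q\right),\ \tfrac{n+1}{4}-\tfrac{n-1}{2q}\right\}.$$ Consider, for all $f\in H^s(\mathbb{R}^n)$ and a constant $C_{n,q,s}$ independent of $f$, the estimates (i) $\|\sup_{0<t<1}|e^{\pm it\sqrt{-\Delta}}f|\|_{L^q(\mathbb{R}^n)}\le C_{n,q,s}\|f\|_{H^s(\mathbb{R}^n)}$; (ii) $\|\sup_{t\in\mathbb{R}}|e^{\pm it\sqrt{-\Delta}}f|\|_{L^q(\mathbb{R}^n)}\le C_{n,q,s}\|f\|_{H^s(\mathbb{R}^n)}$; (iii) $\|\sup_{0<t<1}|e^{\pm it\sqrt{-\Delta}}f|\|_{L^q(\mathbb{B}^n)}\le C_{n,q,s}\|f\|_{H^s(\mathbb{R}^n)}$; (iv) $\|\sup_{t\in\mathbb{R}}|e^{\pm it\sqrt{-\Delta}}f|\|_{L^q(\mathbb{B}^n)}\le C_{n,q,s}\|f\|_{H^s(\mathbb{R}^n)}$. If (i) holds, then $q\in[2,\infty]$ and $s\ge s_{n,q}$. If (ii) holds, then $q\in[q_n,\infty]$ and $s\ge n(\frac12-\frac1q)$. If (iii) or (iv) holds, then $s\ge\max\{1/2,s_{n,q}\}$.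
   Context: For $f$ on $\mathbb{R}^n$, $\widehat f(\xi)=\int f(x)e^{-2\pi i x\cdot\xi}dx$, and $$e^{\pm it\sqrt{-\Delta}}f(x)=\int_{\mathbb{R}^n}\widehat f(\xi)e^{2\pi i(x\cdot\xi\pm t|\xi|)}\,d\xi .$$ $H^s(\mathbb{R}^n)$ has norm $\|f\|_{H^s}=\big(\int(1+|\xi|)^{2s}|\widehat f(\xi)|^2d\xi\big)^{1/2}$. *)

theory Defs
  imports "HOL-Analysis.Analysis"
begin

definition fourier :: "(real^'n \<Rightarrow> complex) \<Rightarrow> real^'n \<Rightarrow> complex" where
  "fourier f \<xi> = (LINT x|lborel. f x * cis (- 2 * pi * (x \<bullet> \<xi>)))"

definition half_wave :: "real \<Rightarrow> (real^'n \<Rightarrow> complex) \<Rightarrow> real \<Rightarrow> real^'n \<Rightarrow> complex" where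
  "half_wave \<sigma> f t x = (LINT \<xi>|lborel. fourier f \<xi> * cis (2 * pi * (x \<bullet> \<xi> + \<sigma> * t * norm \<xi>)))"

definition Hs_norm :: "real \<Rightarrow> (real^'n \<Rightarrow> complex) \<Rightarrow> real" where
  "Hs_norm s f = sqrt (LINT \<xi>|lborel. (1 + norm \<xi>) powr (2 * s) * (cmod (fourier f \<xi>))\<^sup>2)"

text \<open>Test functions: f in L^1 with hat f in L^1 and ||f||_{H^s} finite; on this class
  f is in H^s and the propagator is given literally by the Fourier integral.\<close>
definition Hs_test :: "real \<Rightarrow> (real^'n \<Rightarrow> complex) \<Rightarrow> bool" where
  "Hs_test s f \<longleftrightarrow> integrable lborel f \<and> integrable lborel (fourier f) \<and>
     integrable lborel (\<lambda>\<xi>. (1 + norm \<xi>) powr (2 * s) * (cmod (fourier f \<xi>))\<^sup>2)"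

definition max_wave :: "real \<Rightarrow> real set \<Rightarrow> (real^'n \<Rightarrow> complex) \<Rightarrow> real^'n \<Rightarrow> ennreal" where
  "max_wave \<sigma> T f x = (SUP t\<in>T. ennreal (cmod (half_wave \<sigma> f t x)))"

definition ennpow :: "ennreal \<Rightarrow> real \<Rightarrow> ennreal" where
  "ennpow x p = (if x = top then top else ennreal (enn2real x powr p))"

definition Lq_norm :: "ereal \<Rightarrow> (real^'n) set \<Rightarrow> (real^'n \<Rightarrow> ennreal) \<Rightarrow> ennreal" where
  "Lq_norm q A F =
     (if q = \<infinity> then Inf {c. AE x in lborel. x \<in> A \<longrightarrow> F x \<le> c}
      else ennpow (\<integral>\<^sup>+ x. indicator A x * ennpow (F x) (real_of_ereal q) \<partial>lborel)
                  (1 / real_of_ereal q))"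

definition inv_exp :: "ereal \<Rightarrow> real" where
  "inv_exp q = (if q = \<infinity> then 0 else 1 / real_of_ereal q)"

definition s_crit :: "nat \<Rightarrow> ereal \<Rightarrow> real" where
  "s_crit n q = max (real n * (1/2 - inv_exp q)) ((real n + 1) / 4 - (real n - 1) / 2 * inv_exp q)"

definition q_crit :: "nat \<Rightarrow> ereal" where
  "q_crit n = (if n = 1 then \<infinity> else ereal (2 * (real n + 1) / (real n - 1)))"

definition max_estimate :: "real \<Rightarrow> ereal \<Rightarrow> real \<Rightarrow> real set \<Rightarrow> (real^'n) set \<Rightarrow> bool" where
  "max_estimate \<sigma> q s T A \<longleftrightarrow> (\<exists>C::real. \<forall>f::real^'n \<Rightarrow> complex. Hs_test s f \<longrightarrow>
      Lq_norm q A (max_wave \<sigma> T f) \<le> ennreal (C * Hs_norm s f))"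

end

theory Submission
  imports Defs "HOL-Probability.Levy"
begin

text \<open>
  All necessary conditions come from Knapp examples. Take \<open>f\<close> whose Fourier transform is a product of
  triangle functions supported in a box of sides \<open>L\<^sub>b\<close>. If the phase \<open>x \<bullet> \<xi> + \<sigma> t |\<xi>|\<close> stays within
  \<open>1/6\<close> of zero on this box for each \<open>x \<in> E\<close> and some \<open>t = t(x) \<in> T\<close>, there is no cancellation,
  and the maximal function is \<open>\<gtrsim> \<Prod> L\<^sub>b\<close> on \<open>E\<close>; hence
  \<open>(\<Prod> L\<^sub>b)\<^sup>1\<^sup>/\<^sup>2 |E|\<^sup>1\<^sup>/\<^sup>q \<lesssim> sup (1 + |\<xi>|)\<^sup>s\<close>, the supremum being over the box.

  For the plate of length \<open>N\<close> and width \<open>\<rho>\<close> one takes \<open>E\<close> of length \<open>\<tau> \<lesssim> N / \<rho>\<^sup>2\<close> and width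
  \<open>1 / \<rho>\<close>. Letting \<open>R \<rightarrow> \<infinity>\<close>, the choices \<open>(N, \<rho>, \<tau>) = (R, R, 1/R)\<close>, \<open>(R, R\<^sup>1\<^sup>/\<^sup>2, 1)\<close> and \<open>(R, 1, 1)\<close>
  give the lower bounds on \<open>s\<close>, and \<open>(1, R\<^sup>-\<^sup>1\<^sup>/\<^sup>2, R)\<close> gives \<open>q \<ge> q\<^sub>n\<close>. The cube of side \<open>1/R\<close> at the
  origin gives \<open>q \<ge> 2\<close>.
\<close>

section \<open>The Fourier transform of the squared sinc function\<close>

text \<open>Since \<open>(sin x)\<^sup>2\<close> is at most both \<open>1\<close> and
  \<open>x\<^sup>2\<close>, the quotient is dominated by \<open>2 / (1 + x\<^sup>2)\<close>; at
  \<open>x = 0\<close> it is \<open>0\<close> by the convention for division.\<close>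

lemma integrable_sinc_square:
  "integrable lborel (\<lambda>x::real. (sin x / x)\<^sup>2)"
proof (rule Bochner_Integration.integrable_bound)
  have "set_integrable lborel (einterval (-\<infinity>) \<infinity>) (\<lambda>x. inverse (1 + x\<^sup>2))"
    by (rule integrable_inverse_1_plus_square)
  then have "integrable lborel (\<lambda>x::real. inverse (1 + x\<^sup>2))"
    by (simp add: set_integrable_def)
  then show "integrable lborel (\<lambda>x::real. 2 * inverse (1 + x\<^sup>2))"
    by simp
  show "AE x in lborel. norm ((sin x / x)\<^sup>2) \<le> norm (2 * inverse (1 + (x::real)\<^sup>2))"
  proof (rule AE_I2)
    fix x :: real
    show "norm ((sin x / x)\<^sup>2) \<le> norm (2 * inverse (1 + x\<^sup>2))"
    proof (cases "x = 0")
      case False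
      have s1: "(sin x)\<^sup>2 \<le> 1"
        by (simp add: abs_square_le_1)
      have s2: "(sin x)\<^sup>2 \<le> x\<^sup>2"
        using abs_sin_x_le_abs_x[of x] by (simp add: abs_le_square_iff)
      have "(sin x)\<^sup>2 * x\<^sup>2 \<le> 1 * x\<^sup>2"
        using s1 by (rule mult_right_mono) simp
      with s2 have "(sin x)\<^sup>2 * (1 + x\<^sup>2) \<le> 2 * x\<^sup>2"
        by (simp add: algebra_simps)
      then have "(sin x)\<^sup>2 / x\<^sup>2 \<le> 2 / (1 + x\<^sup>2)"
        using False by (simp add: divide_simps add_pos_nonneg)
      then show ?thesis
        by (simp add: power_divide inverse_eq_divide)
    qed simp
  qed
qed simp

lemma iexp_diff_uminus: "iexp t - iexp (- t) = 2 * \<i> * of_real (sin t)"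
  by (simp add: complex_eq_iff Re_exp Im_exp)

text \<open>The density is \<open>1 / 2\<close> on the interval, and
  \<open>iexp (t * x) / (2 * \<i> * t)\<close> is an antiderivative of
  \<open>iexp (t * x) / 2\<close>. At \<open>t = 0\<close> the formula would give \<open>0\<close>,
  by division by zero, instead of \<open>1\<close>.\<close>

lemma char_uniform_symmetric:
  assumes "t \<noteq> 0"
  shows "char (uniform_measure lborel {-1..1}) t = of_real (sin t / t)"
proof -
  have "uniform_measure lborel {-1..1::real} = density lborel (\<lambda>x. ennreal (indicator {-1..1} x / 2))"
    unfolding uniform_measure_def
    by (intro density_cong) (auto simp: divide_ennreal[symmetric] split: split_indicator)
  then have "char (uniform_measure lborel {-1..1}) t =
      (CLINT x|lborel. (indicator {-1..1} x / 2) *\<^sub>R iexp (t * x))"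
    unfolding char_def
    by (simp add: integral_density)
  also have "\<dots> = (CLINT x|lborel. indicator {-1..1} x *\<^sub>R (iexp (t * x) / 2))"
    by (intro Bochner_Integration.integral_cong) (auto split: split_indicator simp: scaleR_conv_of_real)
  also have "\<dots> = iexp (t * 1) / (2 * \<i> * t) - iexp (t * (-1)) / (2 * \<i> * t)"
  proof (rule integral_FTC_Icc)
    fix x :: real
    show "((\<lambda>x. iexp (t * x) / (2 * \<i> * t)) has_vector_derivative iexp (t * x) / 2) (at x within {-1..1})"
      using assms
      by (auto intro!: derivative_eq_intros has_vector_derivative_real_field simp: field_simps)
  qed (auto intro!: continuous_intros)
  also have "\<dots> = of_real (sin t / t)"
    using assms iexp_diff_uminus[of t] by (simp add: diff_divide_distrib[symmetric])
  finally show ?thesis .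
qed

text \<open>Levy inversion for the uniform distribution on \<open>[-1, 1]\<close> and the interval \<open>(m - 1, m + 1]\<close>: the interval
  contributes a second factor \<open>2 sin t / t\<close>, so the limit is that of \<open>(sin t / t)\<^sup>2\<close>.\<close>

lemma fourier_sinc_square:
  fixes m :: real
  shows "(CLINT t|lborel. of_real ((sin t / t)\<^sup>2) * iexp (- (t * m))) = of_real (pi * max 0 (1 - \<bar>m\<bar> / 2))"
proof -
  define M where "M = uniform_measure lborel {-1..1::real}"
  interpret M: prob_space M
    unfolding M_def by (rule prob_space_uniform_measure) auto
  interpret M: real_distribution M
    by unfold_locales (simp_all add: M_def)
  have meas: "measure M B = measure lborel ({-1..1} \<inter> B) / 2" if "B \<in> sets borel" for B
    unfolding M_def using that by (subst measure_uniform_measure) auto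
  have Mab: "measure M {m - 1<..m + 1} = max 0 (1 - \<bar>m\<bar> / 2)"
  proof -
    show ?thesis
    proof (cases "m < 0")
      case True
      then have "{-1..1} \<inter> {m - 1<..m + 1} = {-1..m+1}" by auto
      then show ?thesis using True by (subst meas) auto
    next
      case False
      \<comment> \<open>Adding the endpoint \<open>m - 1\<close> changes only a null set and leaves
        a closed interval, empty for \<open>m > 2\<close>.\<close>
      have "measure lborel ({-1..1} \<inter> {m - 1<..m + 1}) = measure lborel {m - 1..1}"
      proof (rule measure_eq_AE)
        show "AE x in lborel. (x \<in> {-1..1} \<inter> {m - 1<..m + 1}) = (x \<in> {m - 1..1})"
          using AE_lborel_singleton[of "m - 1"] by eventually_elim (use False in auto)
      qed auto
      then show ?thesis using False by (subst meas) auto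
    qed
  qed
  \<comment> \<open>Levy inversion requires that the endpoints of the interval are not
    atoms.\<close>
  have 0: "measure M {x} = 0" for x
    using meas[of "{x}"] by (cases "x \<in> {-1..1}") (auto simp: Int_absorb1 Int_insert_right)
  let ?g = "\<lambda>t. of_real ((sin t / t)\<^sup>2) * iexp (- (t * m)) :: complex"
  have intg: "integrable lborel ?g"
    by (rule Bochner_Integration.integrable_bound[OF integrable_sinc_square])
       (auto simp: norm_mult norm_power norm_divide power2_eq_square)
  \<comment> \<open>The kernel of the interval is \<open>iexp (- (t * m))\<close> times
    \<open>2 * sin t / t\<close>, and \<open>char M\<close> supplies the other factor
    \<open>sin t / t\<close>. At \<open>t = 0\<close> both sides are \<open>0\<close>.\<close>
  have eq: "(iexp (-(t * (m - 1))) - iexp (-(t * (m + 1)))) / (\<i> * t) * char M t = 2 * ?g t" for t :: real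
  proof (cases "t = 0")
    case False
    have "iexp (-(t * (m - 1))) - iexp (-(t * (m + 1))) = iexp (-(t*m)) * (iexp t - iexp (-t))"
      by (simp add: algebra_simps flip: exp_add)
    also have "iexp t - iexp (-t) = 2 * \<i> * of_real (sin t)"
      by (rule iexp_diff_uminus)
    finally show ?thesis
      using False unfolding M_def
      by (simp add: char_uniform_symmetric power2_eq_square)
  qed simp
  have lim1: "(\<lambda>T::nat. 1 / (2 * pi) * (CLBINT t=-real T..real T. 2 * ?g t)) \<longlonglongrightarrow> of_real (max 0 (1 - \<bar>m\<bar> / 2))"
    using M.Levy_Inversion[of "m - 1" "m + 1"] unfolding eq Mab by (simp add: 0)
  \<comment> \<open>Levy inversion only yields a limit of truncated integrals; as \<open>?g\<close>
    is absolutely integrable, dominated convergence identifies this limit with the full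
    integral.\<close>
  have "(\<lambda>T::nat. CLBINT t=-real T..real T. ?g t) \<longlonglongrightarrow> (CLINT t|lborel. ?g t)"
  proof -
    have "(\<lambda>T::nat. CLINT t|lborel. indicator {-real T<..<real T} t *\<^sub>R ?g t) \<longlonglongrightarrow> (CLINT t|lborel. ?g t)"
    proof (rule integral_dominated_convergence[where w = "\<lambda>t. norm (?g t)"])
      show "AE t in lborel. (\<lambda>T::nat. indicator {-real T<..<real T} t *\<^sub>R ?g t) \<longlonglongrightarrow> ?g t"
      proof (rule AE_I2)
        fix t :: real
        obtain N :: nat where N: "\<bar>t\<bar> < real N" using reals_Archimedean2 by blast
        have "\<forall>\<^sub>F T in sequentially. indicator {-real T<..<real T} t *\<^sub>R ?g t = ?g t"
          using eventually_ge_at_top[of N] by eventually_elim (use N in \<open>auto simp: indicator_def\<close>)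
        then show "(\<lambda>T::nat. indicator {-real T<..<real T} t *\<^sub>R ?g t) \<longlonglongrightarrow> ?g t"
          by (rule tendsto_eventually)
      qed
    qed (use intg in \<open>auto split: split_indicator intro: integrable_norm\<close>)
    then show ?thesis
      by (simp add: interval_lebesgue_integral_def set_lebesgue_integral_def)
  qed
  then have "(\<lambda>T::nat. 1 / (2 * pi) * (2 * (CLBINT t=-real T..real T. ?g t))) \<longlonglongrightarrow> 1 / (2 * pi) * (2 * (CLINT t|lborel. ?g t))"
    by (intro tendsto_intros)
  moreover have "(\<lambda>T::nat. 1 / (2 * pi) * (2 * (CLBINT t=-real T..real T. ?g t))) \<longlonglongrightarrow> of_real (max 0 (1 - \<bar>m\<bar> / 2))"
    using lim1 by (simp only: interval_lebesgue_integral_mult_right)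
  ultimately have "1 / (2 * pi) * (2 * (CLINT t|lborel. ?g t)) = of_real (max 0 (1 - \<bar>m\<bar> / 2))"
    by (rule LIMSEQ_unique)
  then show ?thesis by (simp add: field_simps)
qed


section \<open>Triangle functions and Fejer kernels on the line\<close>

definition triangle :: "real \<Rightarrow> real \<Rightarrow> real \<Rightarrow> real" where
  "triangle c L \<xi> = max 0 (1 - \<bar>\<xi> - c\<bar> / L)"

text \<open>At \<open>x = 0\<close> division by zero gives the value \<open>0\<close> instead of \<open>L\<close>; a null set does not matter here.\<close>

definition fejer :: "real \<Rightarrow> real \<Rightarrow> real \<Rightarrow> complex" where
  "fejer c L x = of_real (L * (sin (pi * L * x) / (pi * L * x))\<^sup>2) * cis (2 * pi * c * x)"

lemma integrable_fejer:
  assumes "L > 0"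
  shows "integrable lborel (fejer c L)"
proof (rule Bochner_Integration.integrable_bound)
  \<comment> \<open>The summand \<open>0\<close> puts the argument into the affine form that the
    change of variables expects.\<close>
  have "integrable lborel (\<lambda>x. (sin (0 + pi * L * x) / (0 + pi * L * x))\<^sup>2)"
    using assms by (intro lborel_integrable_real_affine integrable_sinc_square) auto
  then show "integrable lborel (\<lambda>x. L * (sin (pi * L * x) / (pi * L * x))\<^sup>2)"
    by simp
  show "fejer c L \<in> borel_measurable lborel"
    unfolding fejer_def[abs_def] cis_conv_exp by simp
  show "AE x in lborel. norm (fejer c L x) \<le> norm (L * (sin (pi * L * x) / (pi * L * x))\<^sup>2)"
    by (simp add: fejer_def norm_mult del: of_real_mult of_real_power of_real_divide)
qed

lemma fourier_fejer:
  assumes "L > 0"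
  shows "(LINT x|lborel. fejer c L x * cis (- 2 * pi * (x * \<xi>))) = of_real (triangle c L \<xi>)"
proof -
  \<comment> \<open>The substitution \<open>t = pi * L * x\<close> turns the frequency offset
    \<open>\<xi> - c\<close> into \<open>m\<close>, scaled so that
    \<open>\<bar>m\<bar> / 2 = \<bar>\<xi> - c\<bar> / L\<close>.\<close>
  define m where "m = 2 * (\<xi> - c) / L"
  let ?g = "\<lambda>t. of_real ((sin t / t)\<^sup>2) * iexp (- (t * m)) :: complex"
  have eq: "fejer c L x * cis (- 2 * pi * (x * \<xi>)) = of_real L * ?g (0 + pi * L * x)" for x
  proof -
    have "cis (2 * pi * c * x) * cis (- 2 * pi * (x * \<xi>)) = iexp (- (pi * L * x * m))"
      using assms unfolding cis_mult cis_conv_exp[symmetric] m_def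
      by (intro arg_cong[where f = cis]) (simp add: field_simps)
    then show ?thesis
      by (simp add: fejer_def mult_ac)
  qed
  have "of_real (pi * max 0 (1 - \<bar>m\<bar> / 2)) = (LINT t|lborel. ?g t)"
    by (rule fourier_sinc_square[symmetric])
  also have "\<dots> = \<bar>pi * L\<bar> *\<^sub>R (LINT x|lborel. ?g (0 + pi * L * x))"
    using assms by (intro lborel_integral_real_affine) auto
  also have "\<dots> = of_real pi * (LINT x|lborel. of_real L * ?g (0 + pi * L * x))"
    unfolding integral_mult_right_zero using assms by (simp add: scaleR_conv_of_real)
  finally have "of_real (max 0 (1 - \<bar>m\<bar> / 2)) = (LINT x|lborel. of_real L * ?g (0 + pi * L * x))"
    by simp
  moreover have "\<bar>m\<bar> / 2 = \<bar>\<xi> - c\<bar> / L"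
    using assms unfolding m_def abs_divide abs_mult by simp
  ultimately show ?thesis
    unfolding eq triangle_def by simp
qed

section \<open>Products over coordinates: box bumps and their Fourier transforms\<close>

text \<open>Lebesgue measure is the image of the product measure on coordinate functions under
  \<open>f \<mapsto> (\<Sum>b\<in>Basis. f b *\<^sub>R b)\<close>, so Fubini for finite products
  applies.\<close>

lemma
  fixes g :: "'a::euclidean_space \<Rightarrow> real \<Rightarrow> 'b::{real_normed_field,banach,second_countable_topology}"
  assumes int: "\<And>b. b \<in> Basis \<Longrightarrow> integrable lborel (g b)"
  shows integrable_lborel_prod_Basis: "integrable lborel (\<lambda>x. \<Prod>b\<in>Basis. g b (x \<bullet> b))"
    and integral_lborel_prod_Basis:
      "(LINT x|lborel. (\<Prod>b\<in>Basis. g b (x \<bullet> b))) = (\<Prod>b\<in>Basis. LINT t|lborel. g b t)"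
proof -
  interpret product_sigma_finite "\<lambda>_::'a. lborel :: real measure" by standard
  have [measurable]: "g b \<in> borel_measurable borel" if "b \<in> Basis" for b
    using borel_measurable_integrable[OF int[OF that]] by simp
  have meas: "(\<lambda>f. \<Sum>b\<in>Basis. f b *\<^sub>R b) \<in> measurable (Pi\<^sub>M Basis (\<lambda>_::'a. lborel)) borel"
    by simp
  have meas2: "(\<lambda>x. \<Prod>b\<in>Basis. g b (x \<bullet> b)) \<in> borel_measurable borel"
    by measurable
  have eq: "(\<Prod>b\<in>Basis. g b ((\<Sum>b\<in>Basis. f b *\<^sub>R b) \<bullet> b)) = (\<Prod>b\<in>Basis. g b (f b))" for f
    by (intro prod.cong) (auto simp: inner_sum_left_Basis)
  show "integrable lborel (\<lambda>x. \<Prod>b\<in>Basis. g b (x \<bullet> b))"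
    by (subst lborel_eq, subst integrable_distr_eq[OF meas meas2])
       (simp add: eq product_integrable_prod int)
  show "(LINT x|lborel. (\<Prod>b\<in>Basis. g b (x \<bullet> b))) = (\<Prod>b\<in>Basis. LINT t|lborel. g b t)"
    by (subst lborel_eq, subst integral_distr[OF meas meas2])
       (simp add: eq product_integral_prod int)
qed

lemma cis_sum: "finite A \<Longrightarrow> cis (\<Sum>a\<in>A. f a) = (\<Prod>a\<in>A. cis (f a))"
  by (induction A rule: finite_induct) (auto simp: cis_mult[symmetric])

text \<open>Here \<open>c b\<close> is the centre and \<open>L b\<close> the half-width, in
  direction \<open>b\<close>, of the box that supports the Fourier transform.\<close>

definition box_bump :: "(real^'n \<Rightarrow> real) \<Rightarrow> (real^'n \<Rightarrow> real) \<Rightarrow> real^'n \<Rightarrow> complex" where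
  "box_bump c L x = (\<Prod>b\<in>Basis. fejer (c b) (L b) (x \<bullet> b))"

definition box_triangle :: "(real^'n \<Rightarrow> real) \<Rightarrow> (real^'n \<Rightarrow> real) \<Rightarrow> real^'n \<Rightarrow> real" where
  "box_triangle c L \<xi> = (\<Prod>b\<in>Basis. triangle (c b) (L b) (\<xi> \<bullet> b))"

text \<open>The character splits into a product over the coordinates, so the integral is a product
  of the one-dimensional transforms of \<open>fourier_fejer\<close>.\<close>

lemma fourier_box_bump:
  fixes c L :: "real^'n \<Rightarrow> real"
  assumes "\<forall>b\<in>Basis. L b > 0"
  shows "fourier (box_bump c L) \<xi> = of_real (box_triangle c L \<xi>)"
proof -
  have "box_bump c L x * cis (- 2 * pi * (x \<bullet> \<xi>)) =
      (\<Prod>b\<in>Basis. fejer (c b) (L b) (x \<bullet> b) * cis (- 2 * pi * ((x \<bullet> b) * (\<xi> \<bullet> b))))" for x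
    unfolding box_bump_def prod.distrib
    by (subst euclidean_inner) (simp add: sum_distrib_left flip: cis_sum sum_negf)
  then have "fourier (box_bump c L) \<xi> =
      (LINT x|lborel. (\<Prod>b\<in>Basis. (\<lambda>t. fejer (c b) (L b) t * cis (- 2 * pi * (t * (\<xi> \<bullet> b)))) (x \<bullet> b)))"
    unfolding fourier_def by simp
  also have "\<dots> = (\<Prod>b\<in>Basis. LINT t|lborel. fejer (c b) (L b) t * cis (- 2 * pi * (t * (\<xi> \<bullet> b))))"
  proof (rule integral_lborel_prod_Basis)
    fix b :: "real^'n" assume "b \<in> Basis"
    with assms have int: "integrable lborel (fejer (c b) (L b))"
      by (intro integrable_fejer) auto
    note [measurable] = borel_measurable_integrable[OF int]
    show "integrable lborel (\<lambda>t. fejer (c b) (L b) t * cis (- 2 * pi * (t * (\<xi> \<bullet> b))))"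
      by (rule Bochner_Integration.integrable_bound[OF int]) (auto simp: norm_mult cis_conv_exp)
  qed
  also have "\<dots> = (\<Prod>b\<in>Basis. of_real (triangle (c b) (L b) (\<xi> \<bullet> b)))"
    using assms by (intro prod.cong fourier_fejer) auto
  finally show ?thesis by (simp add: box_triangle_def)
qed

lemma triangle_nonneg: "0 \<le> triangle c L \<xi>"
  by (simp add: triangle_def)

lemma triangle_le_1: "L > 0 \<Longrightarrow> triangle c L \<xi> \<le> 1"
  by (simp add: triangle_def)

lemma triangle_eq_0: "L > 0 \<Longrightarrow> L < \<bar>\<xi> - c\<bar> \<Longrightarrow> triangle c L \<xi> = 0"
  by (simp add: triangle_def max_def field_simps)

lemma integrable_triangle:
  assumes "L > 0"
  shows "integrable lborel (triangle c L)"
proof (rule Bochner_Integration.integrable_bound)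
  show "integrable lborel (indicator {c - L..c + L} :: real \<Rightarrow> real)"
    by (rule integrable_real_indicator) (auto simp: emeasure_lborel_Icc_eq)
  have "\<bar>triangle c L x\<bar> \<le> indicator {c - L..c + L} x" for x
    using triangle_nonneg[of c L x] triangle_le_1[OF assms, of c x] triangle_eq_0[OF assms, of x c]
    by (auto simp: indicator_def abs_if split: if_splits)
  then show "AE x in lborel. norm (triangle c L x) \<le> norm (indicator {c - L..c + L} x :: real)"
    by auto
qed (simp add: triangle_def[abs_def])

text \<open>The triangle is at least \<open>1 / 2\<close> on the middle interval of length
  \<open>L\<close>. The exact value is \<open>L\<close>, but only the order of magnitude
  matters.\<close>

lemma integral_triangle_ge:
  assumes "L > 0"
  shows "L / 2 \<le> (LINT \<xi>|lborel. triangle c L \<xi>)"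
proof -
  have "(LINT \<xi>|lborel. indicator {c - L/2..c + L/2} \<xi> / 2) \<le> (LINT \<xi>|lborel. triangle c L \<xi>)"
  proof (rule integral_mono[OF _ integrable_triangle[OF assms]])
    show "integrable lborel (\<lambda>\<xi>. indicator {c - L/2..c + L/2} \<xi> / 2 :: real)"
      by (intro integrable_divide integrable_real_indicator) (auto simp: emeasure_lborel_Icc_eq)
    show "indicator {c - L/2..c + L/2} \<xi> / 2 \<le> triangle c L \<xi>" for \<xi>
      using assms by (auto simp: triangle_def indicator_def max_def abs_if field_simps)
  qed
  then show ?thesis using assms by simp
qed

lemma
  fixes c L :: "real^'n \<Rightarrow> real"
  assumes "\<forall>b\<in>Basis. L b > 0"
  shows integrable_box_bump: "integrable lborel (box_bump c L)"
    and integrable_box_triangle: "integrable lborel (box_triangle c L)"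
    and integral_box_triangle_ge: "(\<Prod>b\<in>Basis. L b / 2) \<le> (LINT \<xi>|lborel. box_triangle c L \<xi>)"
    and box_triangle_nonneg: "0 \<le> box_triangle c L \<xi>"
    and box_triangle_le_1: "box_triangle c L \<xi> \<le> 1"
    and box_triangle_support: "box_triangle c L \<xi> \<noteq> 0 \<Longrightarrow> b \<in> Basis \<Longrightarrow> \<bar>\<xi> \<bullet> b - c b\<bar> \<le> L b"
proof -
  show "integrable lborel (box_bump c L)"
    unfolding box_bump_def[abs_def]
    by (intro integrable_lborel_prod_Basis integrable_fejer assms[rule_format])
  show "integrable lborel (box_triangle c L)"
    unfolding box_triangle_def[abs_def]
    by (intro integrable_lborel_prod_Basis integrable_triangle assms[rule_format])
  show "(\<Prod>b\<in>Basis. L b / 2) \<le> (LINT \<xi>|lborel. box_triangle c L \<xi>)"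
    unfolding box_triangle_def
    using assms by (subst integral_lborel_prod_Basis)
      (auto intro!: integrable_triangle prod_mono integral_triangle_ge simp: less_imp_le)
  show "0 \<le> box_triangle c L \<xi>"
    unfolding box_triangle_def by (intro prod_nonneg) (simp add: triangle_nonneg)
  show "box_triangle c L \<xi> \<le> 1"
    unfolding box_triangle_def by (intro prod_le_1) (simp add: triangle_nonneg triangle_le_1 assms)
  show "\<bar>\<xi> \<bullet> b - c b\<bar> \<le> L b" if "box_triangle c L \<xi> \<noteq> 0" "b \<in> Basis"
    using that triangle_eq_0[OF assms[rule_format, OF that(2)], of "\<xi> \<bullet> b" "c b"]
    by (auto simp: box_triangle_def not_less[symmetric])
qed

section \<open>Lower bounds for the maximal function and the test on a box\<close>

lemma ennpow_mono:
  assumes "x \<le> y" "0 \<le> p"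
  shows "ennpow x p \<le> ennpow y p"
proof (cases "y = top")
  case False
  with assms have "enn2real x \<le> enn2real y"
    by (simp add: enn2real_mono top.not_eq_extremum)
  with False assms show ?thesis
    by (auto simp: ennpow_def top_unique intro!: ennreal_leI powr_mono2)
qed (simp add: ennpow_def)

lemma ennpow_ennreal: "0 \<le> m \<Longrightarrow> ennpow (ennreal m) p = ennreal (m powr p)"
  by (simp add: ennpow_def)

text \<open>On \<open>A\<close> the function \<open>F\<close> dominates \<open>m\<close> times the
  indicator of \<open>E\<close>, and the left-hand side is the norm of the latter.\<close>

lemma Lq_norm_ge:
  fixes A E :: "(real^'n) set"
  assumes q: "1 \<le> q" and E: "E \<in> sets lborel" "E \<subseteq> A" "0 < measure lborel E"
    and m: "0 \<le> m" "\<And>x. x \<in> E \<Longrightarrow> ennreal m \<le> F x"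
  shows "ennreal (m * measure lborel E powr inv_exp q) \<le> Lq_norm q A F"
proof -
  \<comment> \<open>As \<open>measure\<close> is \<open>0\<close> on sets of infinite measure, its
    positivity also encodes finiteness.\<close>
  have fin: "emeasure lborel E \<noteq> \<infinity>" and pos: "emeasure lborel E \<noteq> 0"
    using E(3) by (auto simp: measure_def)
  have eE: "emeasure lborel E = ennreal (measure lborel E)"
    using fin by (simp add: emeasure_eq_ennreal_measure)
  show ?thesis
  proof (cases "q = \<infinity>")
    case True
    \<comment> \<open>An essential bound below \<open>m\<close> would force \<open>E\<close> to be a
      null set.\<close>
    have "ennreal m \<le> c" if "AE x in lborel. x \<in> A \<longrightarrow> F x \<le> c" for c
    proof (rule ccontr)
      assume less: "\<not> ennreal m \<le> c"
      have "AE x in lborel. x \<notin> E"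
        using that by eventually_elim (use E(2) m(2) less in \<open>auto dest: order_trans\<close>)
      then have "emeasure lborel E = 0"
        using E(1) by (subst (asm) AE_iff_measurable[of E]) auto
      with pos show False by simp
    qed
    with True E show ?thesis
      by (auto simp: Lq_norm_def inv_exp_def intro!: Inf_greatest)
  next
    case False
    define p where "p = real_of_ereal q"
    have p: "p \<ge> 1"
      using q False by (cases q) (auto simp: p_def)
    let ?I = "\<integral>\<^sup>+ x. indicator A x * ennpow (F x) p \<partial>lborel"
    have "ennreal (m powr p * measure lborel E) = (\<integral>\<^sup>+ x. ennreal (m powr p) * indicator E x \<partial>lborel)"
      using E by (subst nn_integral_cmult_indicator) (auto simp: eE ennreal_mult)
    also have "\<dots> \<le> ?I"
    proof (rule nn_integral_mono)
      fix x
      show "ennreal (m powr p) * indicator E x \<le> indicator A x * ennpow (F x) p"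
        using E(2) ennpow_mono[of "ennreal m" "F x" p] m p
        by (auto simp: ennpow_ennreal split: split_indicator)
    qed
    finally have "ennpow (ennreal (m powr p * measure lborel E)) (1 / p) \<le> ennpow ?I (1 / p)"
      using p by (intro ennpow_mono) auto
    moreover have "(m powr p * measure lborel E) powr (1 / p) = m * measure lborel E powr (1 / p)"
      using p m by (simp add: powr_mult powr_powr)
    ultimately show ?thesis
      using False by (simp add: Lq_norm_def inv_exp_def ennpow_ennreal p_def)
  qed
qed

text \<open>A phase of at most \<open>1 / 6\<close> means an angle of at most \<open>pi / 3\<close>,
  whose cosine is at least \<open>1 / 2\<close>. Hence the real part of the integrand is at least
  half of \<open>box_triangle\<close>, and nothing cancels.\<close>

lemma half_wave_box_bump_ge:
  fixes c L :: "real^'n \<Rightarrow> real"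
  assumes L: "\<forall>b\<in>Basis. L b > 0"
    and phase: "\<And>\<xi>. (\<And>b. b \<in> Basis \<Longrightarrow> \<bar>\<xi> \<bullet> b - c b\<bar> \<le> L b) \<Longrightarrow> \<bar>x \<bullet> \<xi> + \<sigma> * t * norm \<xi>\<bar> \<le> 1 / 6"
  shows "(LINT \<xi>|lborel. box_triangle c L \<xi>) / 2 \<le> cmod (half_wave \<sigma> (box_bump c L) t x)"
proof -
  let ?\<phi> = "\<lambda>\<xi>. 2 * pi * (x \<bullet> \<xi> + \<sigma> * t * norm \<xi>)"
  let ?h = "\<lambda>\<xi>. complex_of_real (box_triangle c L \<xi>) * cis (?\<phi> \<xi>)"
  note [measurable] = borel_measurable_integrable[OF integrable_box_triangle[OF L]]
  have int: "integrable lborel ?h"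
    by (rule Bochner_Integration.integrable_bound[OF integrable_box_triangle[OF L]])
       (auto simp: norm_mult cis_conv_exp)
  have "box_triangle c L \<xi> / 2 \<le> Re (?h \<xi>)" for \<xi>
  proof (cases "box_triangle c L \<xi> = 0")
    case False
    then have "\<bar>x \<bullet> \<xi> + \<sigma> * t * norm \<xi>\<bar> \<le> 1 / 6"
      by (intro phase box_triangle_support[OF L])
    then have "\<bar>?\<phi> \<xi>\<bar> \<le> pi / 3"
      by (simp add: abs_mult)
    then have "cos (pi / 3) \<le> cos \<bar>?\<phi> \<xi>\<bar>"
      by (intro cos_monotone_0_pi_le) auto
    then have "1 / 2 \<le> cos (?\<phi> \<xi>)"
      by (simp add: cos_60)
    then have "box_triangle c L \<xi> * (1 / 2) \<le> box_triangle c L \<xi> * cos (?\<phi> \<xi>)"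
      using box_triangle_nonneg[OF L] by (intro mult_left_mono) auto
    then show ?thesis by simp
  qed simp
  then have "(LINT \<xi>|lborel. box_triangle c L \<xi> / 2) \<le> (LINT \<xi>|lborel. Re (?h \<xi>))"
    by (intro integral_mono integrable_Re int integrable_divide integrable_box_triangle L)
  also have "\<dots> = Re (LINT \<xi>|lborel. ?h \<xi>)"
    by (rule integral_Re[OF int])
  also have "\<dots> \<le> cmod (LINT \<xi>|lborel. ?h \<xi>)"
    by (rule complex_Re_le_cmod)
  finally show ?thesis
    using fourier_box_bump[OF L] by (simp add: half_wave_def)
qed

text \<open>Values in \<open>[0, 1]\<close> make the square of \<open>box_triangle\<close> at most
  \<open>box_triangle\<close> itself, so the norm is controlled by the same integral that bounds the
  half wave from below.\<close>

lemma
  fixes c L :: "real^'n \<Rightarrow> real"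
  assumes L: "\<forall>b\<in>Basis. L b > 0"
    and K: "\<And>\<xi>. (\<And>b. b \<in> Basis \<Longrightarrow> \<bar>\<xi> \<bullet> b - c b\<bar> \<le> L b) \<Longrightarrow> (1 + norm \<xi>) powr (2 * s) \<le> K"
  shows Hs_test_box_bump: "Hs_test s (box_bump c L)"
    and Hs_norm_box_bump_le: "Hs_norm s (box_bump c L) \<le> sqrt (K * (LINT \<xi>|lborel. box_triangle c L \<xi>))"
proof -
  note F = fourier_box_bump[OF L]
  note [measurable] = borel_measurable_integrable[OF integrable_box_triangle[OF L]]
  have le: "(1 + norm \<xi>) powr (2 * s) * (cmod (fourier (box_bump c L) \<xi>))\<^sup>2 \<le> K * box_triangle c L \<xi>" for \<xi>
  proof (cases "box_triangle c L \<xi> = 0")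
    case False
    have "(1 + norm \<xi>) powr (2 * s) \<le> K"
      by (intro K box_triangle_support[OF L] False)
    moreover have "(box_triangle c L \<xi>)\<^sup>2 \<le> box_triangle c L \<xi>"
      using box_triangle_le_1[OF L] box_triangle_nonneg[OF L]
      by (simp add: power2_eq_square mult_left_le)
    ultimately show ?thesis
      using order_trans[OF powr_ge_zero, of _ _ K] by (auto simp: F intro!: mult_mono)
  qed (simp add: F)
  have intK: "integrable lborel (\<lambda>\<xi>. K * box_triangle c L \<xi>)"
    by (intro integrable_mult_right integrable_box_triangle L)
  have int: "integrable lborel (\<lambda>\<xi>. (1 + norm \<xi>) powr (2 * s) * (cmod (fourier (box_bump c L) \<xi>))\<^sup>2)"
  proof (rule Bochner_Integration.integrable_bound[OF intK])
    show "AE \<xi> in lborel. norm ((1 + norm \<xi>) powr (2 * s) * (cmod (fourier (box_bump c L) \<xi>))\<^sup>2)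
        \<le> norm (K * box_triangle c L \<xi>)"
      using order_trans[OF le abs_ge_self] by (simp add: abs_mult)
  qed (simp add: F)
  then show "Hs_test s (box_bump c L)"
    using integrable_box_triangle[OF L] integrable_box_bump[OF L]
    by (simp add: Hs_test_def F F[THEN ext])
  show "Hs_norm s (box_bump c L) \<le> sqrt (K * (LINT \<xi>|lborel. box_triangle c L \<xi>))"
    unfolding Hs_norm_def using integral_mono[OF int intK le] by simp
qed

text \<open>With \<open>P\<close> the integral of \<open>box_triangle\<close>, the maximal function
  is at least \<open>P / 2\<close> on \<open>E\<close> and the Sobolev norm is at most
  \<open>sqrt (K * P)\<close>; division by \<open>sqrt P\<close> gives the claim. The constant is
  chosen before the box and \<open>E\<close>, so families of examples can be compared.\<close>

lemma max_estimate_box: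
  fixes A :: "(real^'n) set"
  assumes est: "max_estimate \<sigma> q s T A" and q: "1 \<le> q"
  obtains C where "0 \<le> C"
    "\<And>c L E K. (\<forall>b\<in>Basis. L b > 0) \<Longrightarrow> E \<in> sets lborel \<Longrightarrow> E \<subseteq> A \<Longrightarrow> 0 < measure lborel E \<Longrightarrow>
      (\<And>x. x \<in> E \<Longrightarrow> \<exists>t\<in>T. \<forall>\<xi>. (\<forall>b\<in>Basis. \<bar>\<xi> \<bullet> b - c b\<bar> \<le> L b) \<longrightarrow> \<bar>x \<bullet> \<xi> + \<sigma> * t * norm \<xi>\<bar> \<le> 1 / 6) \<Longrightarrow>
      (\<And>\<xi>. (\<And>b. b \<in> Basis \<Longrightarrow> \<bar>\<xi> \<bullet> b - c b\<bar> \<le> L b) \<Longrightarrow> (1 + norm \<xi>) powr (2 * s) \<le> K) \<Longrightarrow>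
      sqrt (\<Prod>b\<in>Basis. L b / 2) * measure lborel E powr inv_exp q \<le> C * sqrt K"
proof -
  obtain C where C: "\<And>f::real^'n \<Rightarrow> complex. Hs_test s f \<Longrightarrow> Lq_norm q A (max_wave \<sigma> T f) \<le> ennreal (C * Hs_norm s f)"
    using est unfolding max_estimate_def by auto
  show thesis
  \<comment> \<open>The factor \<open>2\<close> undoes the one in \<open>P / 2\<close>; the absolute
    value is there because \<open>max_estimate\<close> allows any real constant.\<close>
  proof (rule that[of "2 * \<bar>C\<bar>"])
    fix c L :: "real^'n \<Rightarrow> real" and E K
    assume L: "\<forall>b\<in>Basis. L b > 0" and E: "E \<in> sets lborel" "E \<subseteq> A" "0 < measure lborel E"
      and ph: "\<And>x. x \<in> E \<Longrightarrow> \<exists>t\<in>T. \<forall>\<xi>. (\<forall>b\<in>Basis. \<bar>\<xi> \<bullet> b - c b\<bar> \<le> L b) \<longrightarrow> \<bar>x \<bullet> \<xi> + \<sigma> * t * norm \<xi>\<bar> \<le> 1 / 6"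
      and K: "\<And>\<xi>. (\<And>b. b \<in> Basis \<Longrightarrow> \<bar>\<xi> \<bullet> b - c b\<bar> \<le> L b) \<Longrightarrow> (1 + norm \<xi>) powr (2 * s) \<le> K"
    define P where "P = (LINT \<xi>|lborel. box_triangle c L \<xi>)"
    define W where "W = measure lborel E powr inv_exp q"
    have PL: "(\<Prod>b\<in>Basis. L b / 2) \<le> P"
      unfolding P_def by (rule integral_box_triangle_ge[OF L])
    have "0 < (\<Prod>b\<in>Basis. L b / 2)"
      using L by (intro prod_pos) auto
    with PL have P: "0 < P" by simp
    have H0: "0 \<le> Hs_norm s (box_bump c L)"
      by (simp add: Hs_norm_def)
    have "ennreal (P / 2 * W) \<le> Lq_norm q A (max_wave \<sigma> T (box_bump c L))"
      unfolding W_def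
    proof (rule Lq_norm_ge[OF q E])
      fix x assume "x \<in> E"
      from ph[OF this] obtain t where t: "t \<in> T"
        "\<And>\<xi>. (\<And>b. b \<in> Basis \<Longrightarrow> \<bar>\<xi> \<bullet> b - c b\<bar> \<le> L b) \<Longrightarrow> \<bar>x \<bullet> \<xi> + \<sigma> * t * norm \<xi>\<bar> \<le> 1 / 6"
        by blast
      have "ennreal (P / 2) \<le> ennreal (cmod (half_wave \<sigma> (box_bump c L) t x))"
        unfolding P_def by (intro ennreal_leI half_wave_box_bump_ge L t(2))
      also have "\<dots> \<le> max_wave \<sigma> T (box_bump c L) x"
        unfolding max_wave_def by (rule SUP_upper[OF t(1)])
      finally show "ennreal (P / 2) \<le> max_wave \<sigma> T (box_bump c L) x" .
    qed (use P in auto)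
    also have "\<dots> \<le> ennreal (C * Hs_norm s (box_bump c L))"
      by (rule C[OF Hs_test_box_bump[OF L K]])
    also have "\<dots> \<le> ennreal (\<bar>C\<bar> * sqrt (K * P))"
      using Hs_norm_box_bump_le[OF L K] H0
      by (intro ennreal_leI mult_mono) (auto simp: P_def)
    finally have le: "ennreal (P / 2 * W) \<le> ennreal (\<bar>C\<bar> * sqrt (K * P))" .
    \<comment> \<open>As \<open>ennreal\<close> sends negative numbers to \<open>0\<close>, passing
      back to reals requires a nonnegative right-hand side.\<close>
    have "0 \<le> sqrt (K * P)"
      using order_trans[OF H0 Hs_norm_box_bump_le[OF L K]] by (simp add: P_def)
    with le have "P / 2 * W \<le> \<bar>C\<bar> * sqrt (K * P)"
      by (simp add: ennreal_le_iff)
    then have "sqrt P * (sqrt P * W) \<le> sqrt P * (2 * \<bar>C\<bar> * sqrt K)"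
      using P by (simp add: real_sqrt_mult mult_ac)
    then have "sqrt P * W \<le> 2 * \<bar>C\<bar> * sqrt K"
      using P by (simp add: mult_le_cancel_left)
    moreover have "sqrt (\<Prod>b\<in>Basis. L b / 2) * W \<le> sqrt P * W"
      using PL by (intro mult_right_mono) (auto simp: W_def)
    ultimately show "sqrt (\<Prod>b\<in>Basis. L b / 2) * measure lborel E powr inv_exp q \<le> 2 * \<bar>C\<bar> * sqrt K"
      by (simp add: W_def)
  qed simp
qed

section \<open>Exponent comparison and the geometry of plates\<close>

lemma powr_le_imp_exponent_le:
  fixes \<alpha> \<beta> C :: real
  assumes "\<And>R. 1 \<le> R \<Longrightarrow> R powr \<alpha> \<le> C * R powr \<beta>"
  shows "\<alpha> \<le> \<beta>"
proof (rule ccontr)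
  assume "\<not> \<alpha> \<le> \<beta>"
  then have pos: "\<alpha> - \<beta> > 0" by simp
  \<comment> \<open>Chosen so that \<open>R powr (\<alpha> - \<beta>)\<close> is
    \<open>\<bar>C\<bar> + 1\<close>, which exceeds \<open>C\<close>.\<close>
  define R where "R = (\<bar>C\<bar> + 1) powr (1 / (\<alpha> - \<beta>))"
  have R: "1 \<le> R"
    unfolding R_def using pos by (intro ge_one_powr_ge_zero) auto
  then have "R powr (\<alpha> - \<beta>) \<le> C"
    using assms[OF R] by (simp add: powr_diff field_simps)
  moreover have "R powr (\<alpha> - \<beta>) = \<bar>C\<bar> + 1"
    unfolding R_def using pos by (simp add: powr_powr)
  ultimately show False by simp
qed

lemma prod_Basis_distinguished:
  fixes k :: "real^'n"
  assumes "k \<in> Basis"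
  shows "(\<Prod>b\<in>Basis. if b = k then u else v) = u * (v::real) ^ (CARD('n) - 1)"
proof -
  have "(\<Prod>b\<in>Basis - {k}. if b = k then u else v) = (\<Prod>b\<in>Basis - {k}. v)"
    by (intro prod.cong) auto
  then show ?thesis
    using assms by (simp add: prod.remove[of Basis k] card_Diff_singleton)
qed

lemma measure_lborel_coordinate_box:
  fixes lo hi :: "'a::euclidean_space \<Rightarrow> real"
  assumes "\<And>b. b \<in> Basis \<Longrightarrow> lo b \<le> hi b"
  shows "measure lborel (cbox (\<Sum>b\<in>Basis. lo b *\<^sub>R b) (\<Sum>b\<in>Basis. hi b *\<^sub>R b)) = (\<Prod>b\<in>Basis. hi b - lo b)"
  using assms by (simp add: measure_lborel_cbox_eq inner_sum_left_Basis inner_diff_left)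

text \<open>The power is monotone in \<open>y\<close>, in a direction that depends on the sign of
  \<open>p\<close>. The sum of both endpoint values spares later arguments a case distinction on the
  sign of \<open>s\<close>.\<close>

lemma powr_le_add_endpoints:
  fixes lo hi y p :: real
  assumes "0 < lo" "lo \<le> y" "y \<le> hi"
  shows "y powr p \<le> lo powr p + hi powr p"
proof (cases "0 \<le> p")
  case True
  then have "y powr p \<le> hi powr p" using assms by (intro powr_mono2) auto
  then show ?thesis by (smt (verit) powr_ge_zero)
next
  case False
  then have "y powr p \<le> lo powr p" using assms by (intro powr_mono2') auto
  then show ?thesis by (smt (verit) powr_ge_zero)
qed

lemma norm_le_add_sum_Basis:
  fixes \<xi> :: "'a::euclidean_space"
  assumes "k \<in> Basis" "\<And>b. b \<in> Basis \<Longrightarrow> b \<noteq> k \<Longrightarrow> \<bar>\<xi> \<bullet> b\<bar> \<le> \<rho>"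
  shows "norm \<xi> \<le> \<bar>\<xi> \<bullet> k\<bar> + real (DIM('a) - 1) * \<rho>"
proof -
  have "norm \<xi> \<le> (\<Sum>b\<in>Basis. \<bar>\<xi> \<bullet> b\<bar>)"
    by (rule norm_le_l1)
  also have "\<dots> = \<bar>\<xi> \<bullet> k\<bar> + (\<Sum>b\<in>Basis - {k}. \<bar>\<xi> \<bullet> b\<bar>)"
    using assms(1) by (simp add: sum.remove)
  also have "(\<Sum>b\<in>Basis - {k}. \<bar>\<xi> \<bullet> b\<bar>) \<le> real (card (Basis - {k})) * \<rho>"
    using assms by (intro sum_bounded_above) auto
  finally show ?thesis
    using assms(1) by (simp add: card_Diff_singleton)
qed

text \<open>The half wave attached to a plate \<open>\<xi> \<bullet> k \<sim> N\<close>, \<open>|\<xi>'| \<lesssim> \<rho>\<close> travels in direction \<open>-\<sigma> k\<close>;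
  its dispersion is governed by \<open>norm \<xi> - \<xi> \<bullet> k = |\<xi>'|\<^sup>2 / (norm \<xi> + \<xi> \<bullet> k) \<lesssim> \<rho>\<^sup>2 / N\<close>.\<close>

lemma plate_phase_le:
  fixes k x \<xi> :: "'a::euclidean_space" and N \<rho> \<tau> :: real
  assumes k: "k \<in> Basis" and N: "0 < N" and \<rho>: "0 < \<rho>"
    and \<tau>: "12 * DIM('a) * \<rho>\<^sup>2 * \<tau> \<le> N"
    and xk: "\<bar>x \<bullet> k\<bar> \<le> \<tau>"
    and x: "\<And>b. b \<in> Basis \<Longrightarrow> b \<noteq> k \<Longrightarrow> \<bar>x \<bullet> b\<bar> \<le> 1 / (12 * DIM('a) * \<rho>)"
    and \<xi>k: "N / 2 \<le> \<xi> \<bullet> k"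
    and \<xi>: "\<And>b. b \<in> Basis \<Longrightarrow> b \<noteq> k \<Longrightarrow> \<bar>\<xi> \<bullet> b\<bar> \<le> \<rho>"
  shows "\<bar>x \<bullet> \<xi> - (x \<bullet> k) * norm \<xi>\<bar> \<le> 1 / 6"
proof -
  let ?n = "real DIM('a)" and ?S = "\<Sum>b\<in>Basis - {k}. (x \<bullet> b) * (\<xi> \<bullet> b)"
  have n: "1 \<le> ?n" by (simp add: Suc_le_eq)
  have card: "real (card (Basis - {k})) \<le> ?n"
    by (intro of_nat_mono card_mono) auto
  have "x \<bullet> \<xi> = (x \<bullet> k) * (\<xi> \<bullet> k) + ?S"
    using k by (subst euclidean_inner) (simp add: sum.remove)
  then have eq: "x \<bullet> \<xi> - (x \<bullet> k) * norm \<xi> = ?S - (x \<bullet> k) * (norm \<xi> - \<xi> \<bullet> k)"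
    by (simp add: algebra_simps)
  have "\<bar>?S\<bar> \<le> (\<Sum>b\<in>Basis - {k}. \<bar>(x \<bullet> b) * (\<xi> \<bullet> b)\<bar>)"
    by (rule sum_abs)
  also have "\<dots> \<le> real (card (Basis - {k})) * (1 / (12 * ?n * \<rho>) * \<rho>)"
    unfolding abs_mult using x \<xi> \<rho> by (intro sum_bounded_above mult_mono) auto
  also have "\<dots> \<le> ?n * (1 / (12 * ?n * \<rho>) * \<rho>)"
    using card \<rho> n by (intro mult_right_mono) auto
  also have "\<dots> = 1 / 12"
    using \<rho> n by simp
  finally have S: "\<bar>?S\<bar> \<le> 1 / 12" .
  define D where "D = norm \<xi> - \<xi> \<bullet> k"
  have D0: "0 \<le> D"
    using Cauchy_Schwarz_ineq2[of \<xi> k] k by (simp add: D_def)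
  have "(norm \<xi>)\<^sup>2 = (\<xi> \<bullet> k)\<^sup>2 + (\<Sum>b\<in>Basis - {k}. (\<xi> \<bullet> b)\<^sup>2)"
    using k by (subst power2_norm_eq_inner, subst euclidean_inner) (simp add: sum.remove power2_eq_square)
  also have "(\<Sum>b\<in>Basis - {k}. (\<xi> \<bullet> b)\<^sup>2) \<le> real (card (Basis - {k})) * \<rho>\<^sup>2"
    using \<xi> \<rho> by (intro sum_bounded_above) (metis Diff_iff abs_le_square_iff abs_of_pos singletonI)
  also have "\<dots> \<le> ?n * \<rho>\<^sup>2"
    using card by (intro mult_right_mono) auto
  finally have "D * (norm \<xi> + \<xi> \<bullet> k) \<le> ?n * \<rho>\<^sup>2"
    by (simp add: D_def algebra_simps power2_eq_square)
  \<comment> \<open>Both \<open>norm \<xi>\<close> and \<open>\<xi> \<bullet> k\<close> are at least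
    \<open>N / 2\<close>.\<close>
  moreover have "D * N \<le> D * (norm \<xi> + \<xi> \<bullet> k)"
    using D0 \<xi>k by (intro mult_left_mono) (auto simp: D_def)
  ultimately have "D * N \<le> ?n * \<rho>\<^sup>2" by simp
  moreover have "0 \<le> \<tau>" using xk by simp
  ultimately have "\<tau> * (D * N) \<le> \<tau> * (?n * \<rho>\<^sup>2)"
    by (intro mult_left_mono)
  with \<tau> have "12 * (\<tau> * D) * N \<le> 1 * N"
    by (simp add: algebra_simps)
  then have "\<tau> * D \<le> 1 / 12"
    using N by (simp add: mult_le_cancel_right)
  moreover have "\<bar>(x \<bullet> k) * D\<bar> \<le> \<tau> * D"
    using xk D0 by (simp add: abs_mult mult_right_mono)
  ultimately show ?thesis
    using S unfolding eq D_def[symmetric] by linarith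
qed

section \<open>Knapp plates and the resulting exponent inequality\<close>

text \<open>This is the box test for the frequency plate of length \<open>N\<close> and width
  \<open>\<rho>\<close>, with \<open>E\<close> of length about \<open>\<tau>\<close> and width about
  \<open>1 / \<rho>\<close>. All factors depending on the dimension, \<open>s\<close> and
  \<open>q\<close> are absorbed into \<open>C\<close>, so the result can be read as a comparison of
  powers.\<close>

lemma max_estimate_plate:
  fixes A :: "(real^'n) set"
  assumes est: "max_estimate \<sigma> q s T A" and q: "1 \<le> q" and \<sigma>: "\<sigma> = 1 \<or> \<sigma> = -1"
  obtains C where "0 \<le> C"
    "\<And>N \<rho> \<tau>. 1 \<le> N \<Longrightarrow> 0 < \<rho> \<Longrightarrow> \<rho> \<le> N \<Longrightarrow> 0 < \<tau> \<Longrightarrow> \<rho>\<^sup>2 * \<tau> \<le> N \<Longrightarrow>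
      {0<..\<tau> / (12 * CARD('n))} \<subseteq> T \<Longrightarrow>
      (\<And>x. (\<And>b. b \<in> Basis \<Longrightarrow> \<bar>x \<bullet> b\<bar> \<le> max \<tau> (1 / \<rho>) / (12 * CARD('n))) \<Longrightarrow> x \<in> A) \<Longrightarrow>
      sqrt (N * \<rho> ^ (CARD('n) - 1)) * (\<tau> * (1 / \<rho>) ^ (CARD('n) - 1)) powr inv_exp q \<le> C * N powr s"
proof -
  obtain C where C: "0 \<le> C" and main:
    "\<And>(c::real^'n \<Rightarrow> real) L E K. (\<forall>b\<in>Basis. L b > 0) \<Longrightarrow> E \<in> sets lborel \<Longrightarrow> E \<subseteq> A \<Longrightarrow> 0 < measure lborel E \<Longrightarrow>
      (\<And>x. x \<in> E \<Longrightarrow> \<exists>t\<in>T. \<forall>\<xi>. (\<forall>b\<in>Basis. \<bar>\<xi> \<bullet> b - c b\<bar> \<le> L b) \<longrightarrow> \<bar>x \<bullet> \<xi> + \<sigma> * t * norm \<xi>\<bar> \<le> 1 / 6) \<Longrightarrow>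
      (\<And>\<xi>. (\<And>b. b \<in> Basis \<Longrightarrow> \<bar>\<xi> \<bullet> b - c b\<bar> \<le> L b) \<Longrightarrow> (1 + norm \<xi>) powr (2 * s) \<le> K) \<Longrightarrow>
      sqrt (\<Prod>b\<in>Basis. L b / 2) * measure lborel E powr inv_exp q \<le> C * sqrt K"
    using max_estimate_box[OF est q] by metis
  define n where "n = real CARD('n)"
  define m where "m = CARD('n) - 1"
  have n: "1 \<le> n" by (simp add: n_def Suc_le_eq)
  obtain k :: "real^'n" where k: "k \<in> Basis" using nonempty_Basis by blast
  \<comment> \<open>On the plate \<open>1 + norm \<xi>\<close> lies between \<open>N / 2\<close> and
    \<open>(3 + n) * N\<close>. The numbers \<open>B\<close> and \<open>D\<close> collect the
    constants of the box volume and of the measure of \<open>E\<close>.\<close>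
  define K0 where "K0 = (1 / 2) powr (2 * s) + (3 + n) powr (2 * s)"
  define B where "B = sqrt (1 / 4 * (1 / 2) ^ m)"
  define D where "D = (1 / (24 * n) * (1 / (6 * n)) ^ m) powr inv_exp q"
  have B: "0 < B" and D: "0 < D"
    using n by (auto simp: B_def D_def)
  have K0: "0 \<le> K0" by (simp add: K0_def)
  show thesis
  proof (rule that[of "C * sqrt K0 / (B * D)"])
    show "0 \<le> C * sqrt K0 / (B * D)" using B D C K0 by simp
  next
    fix N \<rho> \<tau> :: real
    assume N: "1 \<le> N" and \<rho>: "0 < \<rho>" "\<rho> \<le> N" and \<tau>: "0 < \<tau>" "\<rho>\<^sup>2 * \<tau> \<le> N"
      and T: "{0<..\<tau> / (12 * CARD('n))} \<subseteq> T"
      and A: "\<And>x. (\<And>b. b \<in> Basis \<Longrightarrow> \<bar>x \<bullet> b\<bar> \<le> max \<tau> (1 / \<rho>) / (12 * CARD('n))) \<Longrightarrow> x \<in> A"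
    define \<theta> where "\<theta> = \<tau> / (12 * n)"
    have \<theta>: "0 < \<theta>" using \<tau> n by (simp add: \<theta>_def)
    define r where "r = 1 / (12 * n * \<rho>)"
    have r: "0 < r" using \<rho> n by (simp add: r_def)
    define c where "c = (\<lambda>b::real^'n. if b = k then N else 0)"
    define L where "L = (\<lambda>b::real^'n. if b = k then N / 2 else \<rho>)"
    \<comment> \<open>The interval in direction \<open>k\<close> is placed so that
      \<open>- \<sigma> * (x \<bullet> k)\<close>, the time to be chosen, lies in
      \<open>[\<theta> / 2, \<theta>]\<close> and is thus positive.\<close>
    define lo where "lo = (\<lambda>b::real^'n. if b = k then - \<sigma> * (3 * \<theta> / 4) - \<theta> / 4 else - r)"
    define hi where "hi = (\<lambda>b::real^'n. if b = k then - \<sigma> * (3 * \<theta> / 4) + \<theta> / 4 else r)"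
    define E where "E = cbox (\<Sum>b\<in>Basis. lo b *\<^sub>R b) (\<Sum>b\<in>Basis. hi b *\<^sub>R b)"
    have E_iff: "x \<in> E \<longleftrightarrow> (\<forall>b\<in>Basis. lo b \<le> x \<bullet> b \<and> x \<bullet> b \<le> hi b)" for x
      by (simp add: E_def mem_box inner_sum_left_Basis)
    have Ek: "0 < - \<sigma> * (x \<bullet> k)" "- \<sigma> * (x \<bullet> k) \<le> \<theta>" "\<bar>x \<bullet> k\<bar> \<le> \<theta>" if "x \<in> E" for x
      using that k \<sigma> \<theta> by (auto simp: E_iff lo_def hi_def dest!: bspec[where x = k])
    have Eb: "\<bar>x \<bullet> b\<bar> \<le> r" if "x \<in> E" "b \<in> Basis" "b \<noteq> k" for x b
      using that by (auto simp: E_iff lo_def hi_def abs_le_iff dest!: bspec[where x = b])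
    have "measure lborel E = (\<Prod>b\<in>Basis. hi b - lo b)"
      unfolding E_def using \<theta> r by (intro measure_lborel_coordinate_box) (auto simp: lo_def hi_def)
    also have "\<dots> = (\<Prod>b\<in>Basis. if b = k then \<theta> / 2 else 2 * r)"
      by (intro prod.cong) (auto simp: lo_def hi_def)
    also have "\<dots> = \<theta> / 2 * (2 * r) ^ m"
      unfolding m_def by (rule prod_Basis_distinguished[OF k])
    finally have measE: "measure lborel E = \<theta> / 2 * (2 * r) ^ m" .
    have plate: "N / 2 \<le> \<xi> \<bullet> k \<and> \<xi> \<bullet> k \<le> 2 * N \<and> (\<forall>b\<in>Basis. b \<noteq> k \<longrightarrow> \<bar>\<xi> \<bullet> b\<bar> \<le> \<rho>)"
      if "\<And>b. b \<in> Basis \<Longrightarrow> \<bar>\<xi> \<bullet> b - c b\<bar> \<le> L b" for \<xi>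
    proof (intro conjI ballI impI)
      have "\<bar>\<xi> \<bullet> k - N\<bar> \<le> N / 2"
        using that[OF k] by (simp add: c_def L_def)
      then show "N / 2 \<le> \<xi> \<bullet> k" "\<xi> \<bullet> k \<le> 2 * N"
        using N by linarith+
      show "\<bar>\<xi> \<bullet> b\<bar> \<le> \<rho>" if "b \<in> Basis" "b \<noteq> k" for b
        using \<open>\<And>b. b \<in> Basis \<Longrightarrow> \<bar>\<xi> \<bullet> b - c b\<bar> \<le> L b\<close>[OF that(1)] that by (simp add: c_def L_def)
    qed
    have prodL: "sqrt (\<Prod>b\<in>Basis. L b / 2) = B * sqrt (N * \<rho> ^ m)"
    proof -
      have "(\<Prod>b\<in>Basis. L b / 2) = (\<Prod>b\<in>Basis. if b = k then N / 4 else \<rho> / 2)"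
        by (intro prod.cong) (auto simp: L_def)
      also have "\<dots> = (1 / 4 * (1 / 2) ^ m) * (N * \<rho> ^ m)"
        unfolding m_def by (subst prod_Basis_distinguished[OF k]) (simp add: power_divide)
      finally show ?thesis by (simp only: B_def real_sqrt_mult)
    qed
    have powE: "measure lborel E powr inv_exp q = D * (\<tau> * (1 / \<rho>) ^ m) powr inv_exp q"
    proof -
      have "measure lborel E = (1 / (24 * n) * (1 / (6 * n)) ^ m) * (\<tau> * (1 / \<rho>) ^ m)"
        unfolding measE \<theta>_def r_def by (simp add: power_divide power_mult_distrib field_simps)
      then show ?thesis
        unfolding D_def using n \<tau> \<rho> by (subst powr_mult[symmetric]) auto
    qed
    have "sqrt (\<Prod>b\<in>Basis. L b / 2) * measure lborel E powr inv_exp q \<le> C * sqrt (K0 * N powr (2 * s))"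
    proof (rule main)
      show "\<forall>b\<in>Basis. L b > 0" using N \<rho> by (simp add: L_def)
      show "E \<in> sets lborel" by (simp add: E_def)
      show "0 < measure lborel E" using \<theta> r by (simp add: measE)
      show "E \<subseteq> A"
      proof
        fix x assume x: "x \<in> E"
        show "x \<in> A"
        proof (rule A)
          fix b :: "real^'n" assume b: "b \<in> Basis"
          have "\<theta> \<le> max \<tau> (1 / \<rho>) / (12 * n)" "r \<le> max \<tau> (1 / \<rho>) / (12 * n)"
          proof -
            show "\<theta> \<le> max \<tau> (1 / \<rho>) / (12 * n)"
              unfolding \<theta>_def using n by (intro divide_right_mono) auto
            have "r = (1 / \<rho>) / (12 * n)" by (simp add: r_def)
            also have "\<dots> \<le> max \<tau> (1 / \<rho>) / (12 * n)"
              using n by (intro divide_right_mono) auto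
            finally show "r \<le> max \<tau> (1 / \<rho>) / (12 * n)" .
          qed
          then show "\<bar>x \<bullet> b\<bar> \<le> max \<tau> (1 / \<rho>) / (12 * CARD('n))"
            using Ek[OF x] Eb[OF x b] by (cases "b = k") (auto simp: n_def)
        qed
      qed
      show "\<exists>t\<in>T. \<forall>\<xi>. (\<forall>b\<in>Basis. \<bar>\<xi> \<bullet> b - c b\<bar> \<le> L b) \<longrightarrow> \<bar>x \<bullet> \<xi> + \<sigma> * t * norm \<xi>\<bar> \<le> 1 / 6"
        if x: "x \<in> E" for x
      proof (intro bexI allI impI)
        \<comment> \<open>At this time the packet passes \<open>x\<close>: as
          \<open>\<sigma>\<close> squares to \<open>1\<close>, the phase becomes
          \<open>x \<bullet> \<xi> - (x \<bullet> k) * norm \<xi>\<close>.\<close>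
        show "- \<sigma> * (x \<bullet> k) \<in> T"
          using Ek[OF x] T by (auto simp: \<theta>_def n_def)
        fix \<xi> assume "\<forall>b\<in>Basis. \<bar>\<xi> \<bullet> b - c b\<bar> \<le> L b"
        then have \<xi>: "N / 2 \<le> \<xi> \<bullet> k" "\<And>b. b \<in> Basis \<Longrightarrow> b \<noteq> k \<Longrightarrow> \<bar>\<xi> \<bullet> b\<bar> \<le> \<rho>"
          using plate by blast+
        have "\<bar>x \<bullet> \<xi> - (x \<bullet> k) * norm \<xi>\<bar> \<le> 1 / 6"
        proof (rule plate_phase_le[OF k])
          \<comment> \<open>With \<open>\<theta>\<close> in the role of the length, the factor
            \<open>12 * n\<close> cancels and the condition is
            \<open>\<rho>\<^sup>2 * \<tau> \<le> N\<close>.\<close>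
          show "12 * DIM(real^'n) * \<rho>\<^sup>2 * \<theta> \<le> N"
            using \<tau> n by (simp add: \<theta>_def n_def)
          show "\<bar>x \<bullet> b\<bar> \<le> 1 / (12 * DIM(real^'n) * \<rho>)" if "b \<in> Basis" "b \<noteq> k" for b
            using Eb[OF x that] by (simp add: r_def n_def)
        qed (use N \<rho> \<xi> Ek[OF x] in auto)
        moreover have "\<sigma> * (- \<sigma> * (x \<bullet> k)) = - (x \<bullet> k)"
          using \<sigma> by auto
        ultimately show "\<bar>x \<bullet> \<xi> + \<sigma> * (- \<sigma> * (x \<bullet> k)) * norm \<xi>\<bar> \<le> 1 / 6"
          by (simp only: mult_minus_left add_uminus_conv_diff)
      qed
      show "(1 + norm \<xi>) powr (2 * s) \<le> K0 * N powr (2 * s)"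
        if "\<And>b. b \<in> Basis \<Longrightarrow> \<bar>\<xi> \<bullet> b - c b\<bar> \<le> L b" for \<xi>
      proof -
        note \<xi> = plate[OF that]
        have "norm \<xi> \<le> \<bar>\<xi> \<bullet> k\<bar> + real (DIM(real^'n) - 1) * \<rho>"
          using \<xi> by (intro norm_le_add_sum_Basis k) auto
        also have "\<dots> \<le> 2 * N + n * N"
          using \<xi> N \<rho> by (intro add_mono mult_mono) (auto simp: n_def)
        finally have "1 + norm \<xi> \<le> (3 + n) * N"
          using N by (simp add: algebra_simps)
        moreover have "1 / 2 * N \<le> 1 + norm \<xi>"
          using \<xi> Basis_le_norm[OF k, of \<xi>] by simp
        ultimately have "(1 + norm \<xi>) powr (2 * s) \<le> (1 / 2 * N) powr (2 * s) + ((3 + n) * N) powr (2 * s)"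
          using N by (intro powr_le_add_endpoints) auto
        also have "\<dots> = K0 * N powr (2 * s)"
          using N n by (simp only: powr_mult K0_def) (simp add: algebra_simps)
        finally show ?thesis .
      qed
    qed
    moreover have "sqrt (K0 * N powr (2 * s)) = sqrt K0 * N powr s"
      using N by (simp add: real_sqrt_mult powr_half_sqrt[symmetric] powr_powr)
    ultimately have "(B * D) * (sqrt (N * \<rho> ^ m) * (\<tau> * (1 / \<rho>) ^ m) powr inv_exp q) \<le> C * sqrt K0 * N powr s"
      unfolding prodL powE by (simp add: mult_ac)
    then show "sqrt (N * \<rho> ^ (CARD('n) - 1)) * (\<tau> * (1 / \<rho>) ^ (CARD('n) - 1)) powr inv_exp q
        \<le> C * sqrt K0 / (B * D) * N powr s"
      using B D by (simp add: m_def field_simps)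
  qed
qed

text \<open>With \<open>N = R powr a\<close>, \<open>\<rho> = R powr b\<close> and
  \<open>\<tau> = R powr d\<close> the plate inequality compares two powers of \<open>R\<close>,
  hence their exponents as \<open>R\<close> grows. The conditions \<open>exps\<close> encode
  \<open>1 \<le> N\<close>, \<open>\<rho> \<le> N\<close> and
  \<open>\<rho>\<^sup>2 * \<tau> \<le> N\<close>. The second alternative of \<open>dom\<close> makes
  \<open>\<tau>\<close> and \<open>1 / \<rho>\<close> at most \<open>1\<close>, so that
  \<open>E\<close> fits into the unit ball and the times into the unit interval.\<close>

lemma max_estimate_exponents:
  fixes A :: "(real^'n) set" and a b d :: real
  assumes est: "max_estimate \<sigma> q s T A" and q: "1 \<le> q" and \<sigma>: "\<sigma> = 1 \<or> \<sigma> = -1"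
    and exps: "0 \<le> a" "b \<le> a" "2 * b + d \<le> a"
    and dom: "T = UNIV \<and> A = UNIV \<or> d \<le> 0 \<and> 0 \<le> b \<and> {0<..<1} \<subseteq> T \<and> ball 0 1 \<subseteq> A"
  shows "a / 2 + b * (real CARD('n) - 1) / 2 + (d - b * (real CARD('n) - 1)) * inv_exp q \<le> s * a"
proof -
  define n where "n = CARD('n)"
  have n: "1 \<le> n" by (simp add: n_def Suc_le_eq)
  obtain C where C: "0 \<le> C" and main:
    "\<And>N \<rho> \<tau>. 1 \<le> N \<Longrightarrow> 0 < \<rho> \<Longrightarrow> \<rho> \<le> N \<Longrightarrow> 0 < \<tau> \<Longrightarrow> \<rho>\<^sup>2 * \<tau> \<le> N \<Longrightarrow>
      {0<..\<tau> / (12 * n)} \<subseteq> T \<Longrightarrow>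
      (\<And>x. (\<And>b. b \<in> Basis \<Longrightarrow> \<bar>x \<bullet> b\<bar> \<le> max \<tau> (1 / \<rho>) / (12 * n)) \<Longrightarrow> x \<in> A) \<Longrightarrow>
      sqrt (N * \<rho> ^ (n - 1)) * (\<tau> * (1 / \<rho>) ^ (n - 1)) powr inv_exp q \<le> C * N powr s"
    unfolding n_def using max_estimate_plate[OF est q \<sigma>] by metis
  show ?thesis
  proof (rule powr_le_imp_exponent_le[where C = C])
    fix R :: real assume R: "1 \<le> R"
    have pow: "(R powr b) ^ (n - 1) = R powr (b * (real n - 1))"
      using R n by (simp add: powr_power of_nat_diff mult.commute)
    have "sqrt (R powr a * (R powr b) ^ (n - 1)) * (R powr d * (1 / R powr b) ^ (n - 1)) powr inv_exp q
        \<le> C * (R powr a) powr s"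
    proof (rule main)
      show "1 \<le> R powr a" using R exps by (simp add: ge_one_powr_ge_zero)
      show "0 < R powr b" "0 < R powr d" using R by simp_all
      show "R powr b \<le> R powr a" using R exps by (intro powr_mono) auto
      have "(R powr b)\<^sup>2 * R powr d = R powr (2 * b + d)"
        by (simp only: powr_add power2_eq_square mult_2)
      also have "\<dots> \<le> R powr a" using R exps by (intro powr_mono) auto
      finally show "(R powr b)\<^sup>2 * R powr d \<le> R powr a" .
      have le1: "R powr d \<le> 1" "1 / R powr b \<le> 1" if "d \<le> 0" "0 \<le> b"
        using R that powr_mono[of d 0 R] powr_mono[of 0 b R] by (auto simp: divide_le_eq_1)
      show "{0<..R powr d / (12 * n)} \<subseteq> T"
      proof (cases "T = UNIV")
        case False
        with dom have "R powr d \<le> 1" "{0<..<1} \<subseteq> T" using le1 by auto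
        moreover have "R powr d / (12 * n) < 1" using n \<open>R powr d \<le> 1\<close> by (simp add: divide_simps)
        ultimately show ?thesis by force
      qed simp
      show "x \<in> A" if x: "\<And>e. e \<in> Basis \<Longrightarrow> \<bar>x \<bullet> e\<bar> \<le> max (R powr d) (1 / R powr b) / (12 * n)" for x
      proof (cases "A = UNIV")
        case False
        with dom have db: "d \<le> 0" "0 \<le> b" "ball 0 1 \<subseteq> A" by auto
        have "norm x \<le> (\<Sum>e\<in>Basis. \<bar>x \<bullet> e\<bar>)" by (rule norm_le_l1)
        also have "\<dots> \<le> real (card (Basis :: (real^'n) set)) * (1 / (12 * n))"
        proof (rule sum_bounded_above)
          fix e :: "real^'n" assume "e \<in> Basis"
          from x[OF this] show "\<bar>x \<bullet> e\<bar> \<le> 1 / (12 * n)"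
            by (rule order_trans) (use le1[OF db(1,2)] n in \<open>intro divide_right_mono, auto\<close>)
        qed
        also have "\<dots> < 1" using n by (simp add: n_def)
        finally show ?thesis using db by auto
      qed simp
    qed
    moreover have "sqrt (R powr a * (R powr b) ^ (n - 1)) = R powr (a / 2 + b * (real n - 1) / 2)"
    proof -
      have "R powr a * (R powr b) ^ (n - 1) = R powr (a + b * (real n - 1))"
        by (simp only: pow powr_add)
      then show ?thesis
        using R by (simp add: powr_half_sqrt[symmetric] powr_powr add_divide_distrib)
    qed
    moreover have "(R powr d * (1 / R powr b) ^ (n - 1)) powr inv_exp q = R powr ((d - b * (real n - 1)) * inv_exp q)"
    proof -
      have "R powr d * (1 / R powr b) ^ (n - 1) = R powr (d - b * (real n - 1))"
        unfolding power_divide pow powr_diff by simp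
      then show ?thesis by (simp add: powr_powr)
    qed
    ultimately show "R powr (a / 2 + b * (real CARD('n) - 1) / 2 + (d - b * (real CARD('n) - 1)) * inv_exp q)
        \<le> C * R powr (s * a)"
      by (simp only: powr_add powr_powr n_def mult.commute[of s])
  qed
qed

section \<open>Necessary conditions on the exponents\<close>

text \<open>The three examples use only points of the unit ball and times in \<open>(0, 1)\<close>,
  so they apply to all four estimates.\<close>

lemma max_estimate_local_necessary:
  fixes A :: "(real^'n) set"
  assumes est: "max_estimate \<sigma> q s T A" and q: "1 \<le> q" and \<sigma>: "\<sigma> = 1 \<or> \<sigma> = -1"
    and "{0<..<1} \<subseteq> T" "ball 0 1 \<subseteq> A"
  shows "max (1/2) (s_crit CARD('n) q) \<le> s"
proof -
  note E = max_estimate_exponents[OF est q \<sigma>]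
  \<comment> \<open>A plate of unit width sweeps out a set of unit size, so \<open>q\<close> does
    not enter.\<close>
  have "1 / 2 \<le> s"
    using E[of 1 0 0] assms by simp
  \<comment> \<open>A frequency cube of side about \<open>R\<close>: the wave focuses at scale
    \<open>1 / R\<close>.\<close>
  moreover have "real CARD('n) * (1/2 - inv_exp q) \<le> s"
    using E[of 1 1 "-1"] assms by (simp add: algebra_simps add_divide_distrib diff_divide_distrib)
  \<comment> \<open>The classical Knapp plate: \<open>E\<close> is a tube of length about
    \<open>1\<close> and width about \<open>R powr (- 1 / 2)\<close>.\<close>
  moreover have "(real CARD('n) + 1) / 4 - (real CARD('n) - 1) / 2 * inv_exp q \<le> s"
    using E[of 1 "1/2" 0] assms by (simp add: algebra_simps add_divide_distrib diff_divide_distrib)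
  ultimately show ?thesis
    by (simp add: s_crit_def)
qed

text \<open>Low frequencies, where the wave does not move in unit time, force integrability at infinity.\<close>

lemma max_estimate_global_space:
  assumes est: "max_estimate \<sigma> q s T (UNIV :: (real^'n) set)" and q: "1 \<le> q"
    and \<sigma>: "\<sigma> = 1 \<or> \<sigma> = -1" and T: "{0<..<1} \<subseteq> T"
  shows "inv_exp q \<le> 1 / 2"
proof -
  obtain C where C: "0 \<le> C" and main:
    "\<And>(c::real^'n \<Rightarrow> real) L E K. (\<forall>b\<in>Basis. L b > 0) \<Longrightarrow> E \<in> sets lborel \<Longrightarrow> E \<subseteq> UNIV \<Longrightarrow> 0 < measure lborel E \<Longrightarrow>
      (\<And>x. x \<in> E \<Longrightarrow> \<exists>t\<in>T. \<forall>\<xi>. (\<forall>b\<in>Basis. \<bar>\<xi> \<bullet> b - c b\<bar> \<le> L b) \<longrightarrow> \<bar>x \<bullet> \<xi> + \<sigma> * t * norm \<xi>\<bar> \<le> 1 / 6) \<Longrightarrow>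
      (\<And>\<xi>. (\<And>b. b \<in> Basis \<Longrightarrow> \<bar>\<xi> \<bullet> b - c b\<bar> \<le> L b) \<Longrightarrow> (1 + norm \<xi>) powr (2 * s) \<le> K) \<Longrightarrow>
      sqrt (\<Prod>b\<in>Basis. L b / 2) * measure lborel E powr inv_exp q \<le> C * sqrt K"
    using max_estimate_box[OF est q] by metis
  define n where "n = CARD('n)"
  have n: "1 \<le> n" by (simp add: n_def Suc_le_eq)
  \<comment> \<open>The frequencies used have \<open>norm \<xi> \<le> n\<close>, so the weight is
    bounded independently of \<open>R\<close>.\<close>
  define K where "K = 1 powr (2 * s) + (1 + real n) powr (2 * s)"
  define B where "B = sqrt ((1 / 2) ^ n)"
  define D where "D = ((1 / (6 * real n)) ^ n) powr inv_exp q"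
  have B: "0 < B" and D: "0 < D"
    using n by (auto simp: B_def D_def)
  \<comment> \<open>The frequency cube contributes \<open>R powr (- (n / 2))\<close> and
    \<open>E\<close> contributes \<open>R powr (n * inv_exp q)\<close>, up to constants; their
    product must stay bounded.\<close>
  have "n * inv_exp q \<le> n / 2"
  proof (rule powr_le_imp_exponent_le[where C = "C * sqrt K / (B * D)"])
    fix R :: real assume R: "1 \<le> R"
    \<comment> \<open>This bounds \<open>x \<bullet> \<xi>\<close> by
      \<open>n * r / R = 1 / 12\<close>; the fixed time \<open>1 / (12 * n)\<close> leaves at most
      \<open>1 / 12\<close> for the other term.\<close>
    define r where "r = R / (12 * n)"
    have r: "0 < r" using R n by (simp add: r_def)
    define E :: "(real^'n) set" where "E = cbox (\<Sum>b\<in>Basis. (- r) *\<^sub>R b) (\<Sum>b\<in>Basis. r *\<^sub>R b)"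
    have E: "\<bar>x \<bullet> b\<bar> \<le> r" if "x \<in> E" "b \<in> Basis" for x b
      using that by (auto simp: E_def mem_box inner_sum_left_Basis abs_le_iff
          simp del: scaleR_minus_left dest!: bspec[where x = b])
    have "measure lborel E = (\<Prod>b\<in>(Basis :: (real^'n) set). r - (- r))"
      unfolding E_def
      using measure_lborel_coordinate_box[where lo = "\<lambda>_::real^'n. - r" and hi = "\<lambda>_. r"] r
      by (simp del: scaleR_minus_left)
    then have measE: "measure lborel E = (1 / (6 * real n)) ^ n * R ^ n"
      by (simp add: n_def r_def power_divide power_mult_distrib)
    have small: "norm \<xi> \<le> n / R" if "\<And>b. b \<in> Basis \<Longrightarrow> \<bar>\<xi> \<bullet> b - 0\<bar> \<le> 1 / R" for \<xi> :: "real^'n"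
    proof -
      have "norm \<xi> \<le> (\<Sum>b\<in>Basis. \<bar>\<xi> \<bullet> b\<bar>)" by (rule norm_le_l1)
      also have "\<dots> \<le> real (card (Basis :: (real^'n) set)) * (1 / R)"
        using that by (intro sum_bounded_above) auto
      finally show ?thesis by (simp add: n_def)
    qed
    have nR: "n / R \<le> n" using R n by (simp add: divide_simps)
    have "sqrt (\<Prod>b\<in>(Basis :: (real^'n) set). 1 / R / 2) * measure lborel E powr inv_exp q \<le> C * sqrt K"
    proof (rule main[where c = "\<lambda>_. 0"])
      show "\<forall>b\<in>Basis. 0 < 1 / R" using R by simp
      show "E \<in> sets lborel" "E \<subseteq> UNIV" by (simp_all add: E_def)
      show "0 < measure lborel E" using R n by (simp add: measE)
      show "\<exists>t\<in>T. \<forall>\<xi>. (\<forall>b\<in>Basis. \<bar>\<xi> \<bullet> b - 0\<bar> \<le> 1 / R) \<longrightarrow> \<bar>x \<bullet> \<xi> + \<sigma> * t * norm \<xi>\<bar> \<le> 1 / 6"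
        if x: "x \<in> E" for x
      proof (intro bexI allI impI)
        show "1 / (12 * real n) \<in> T"
          using n by (intro subsetD[OF T]) (simp add: divide_simps)
        fix \<xi> :: "real^'n" assume \<xi>: "\<forall>b\<in>Basis. \<bar>\<xi> \<bullet> b - 0\<bar> \<le> 1 / R"
        have "\<bar>x \<bullet> \<xi>\<bar> \<le> (\<Sum>b\<in>Basis. \<bar>(x \<bullet> b) * (\<xi> \<bullet> b)\<bar>)"
          by (subst euclidean_inner) (rule sum_abs)
        also have "\<dots> \<le> real (card (Basis :: (real^'n) set)) * (r * (1 / R))"
          unfolding abs_mult using E[OF x] \<xi> r by (intro sum_bounded_above mult_mono) auto
        also have "\<dots> = 1 / 12"
          using R n by (simp add: r_def n_def)
        finally have 1: "\<bar>x \<bullet> \<xi>\<bar> \<le> 1 / 12" .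
        have "norm \<xi> \<le> n"
          using small[of \<xi>] \<xi> nR by (meson order_trans)
        then have "1 / (12 * real n) * norm \<xi> \<le> 1 / (12 * real n) * n"
          using n by (intro mult_left_mono) auto
        then have "\<bar>\<sigma> * (1 / (12 * real n)) * norm \<xi>\<bar> \<le> 1 / 12"
          using n \<sigma> by (auto simp: abs_mult)
        with 1 show "\<bar>x \<bullet> \<xi> + \<sigma> * (1 / (12 * real n)) * norm \<xi>\<bar> \<le> 1 / 6"
          by linarith
      qed
      show "(1 + norm \<xi>) powr (2 * s) \<le> K"
        if "\<And>b. b \<in> Basis \<Longrightarrow> \<bar>\<xi> \<bullet> b - 0\<bar> \<le> 1 / R" for \<xi> :: "real^'n"
        unfolding K_def using small[OF that] nR by (intro powr_le_add_endpoints) auto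
    qed
    moreover have "sqrt (\<Prod>b\<in>(Basis :: (real^'n) set). 1 / R / 2) = B * R powr (- (n / 2))"
    proof -
      have "(\<Prod>b\<in>(Basis :: (real^'n) set). 1 / R / 2) = (1 / 2) ^ n * R powr (- real n)"
        using R by (simp add: n_def power_divide power_mult_distrib powr_minus powr_realpow divide_simps)
      then show ?thesis
        using R by (simp add: B_def real_sqrt_mult powr_half_sqrt[symmetric] powr_powr)
    qed
    moreover have "measure lborel E powr inv_exp q = D * R powr (n * inv_exp q)"
      using R n by (simp add: measE D_def powr_mult powr_powr flip: powr_realpow)
    ultimately have "B * D * (R powr (- (n / 2)) * R powr (n * inv_exp q)) \<le> C * sqrt K"
      by (simp add: mult_ac)
    then have le: "R powr (- (n / 2)) * R powr (n * inv_exp q) \<le> C * sqrt K / (B * D)"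
      using B D by (simp add: field_simps)
    have "R powr (n * inv_exp q) = R powr (n / 2) * (R powr (- (n / 2)) * R powr (n * inv_exp q))"
      using R by (simp add: powr_minus)
    also have "\<dots> \<le> R powr (n / 2) * (C * sqrt K / (B * D))"
      using le by (rule mult_left_mono) simp
    finally show "R powr (n * inv_exp q) \<le> C * sqrt K / (B * D) * R powr (n / 2)"
      by (simp only: mult.commute)
  qed
  then show ?thesis using n by (simp add: field_simps)
qed

theorem theorem3p1:
  fixes \<sigma> :: real and q :: ereal and s :: real
  assumes "\<sigma> = 1 \<or> \<sigma> = -1"
    and "1 \<le> q"
  shows "(max_estimate \<sigma> q s {0<..<1} (UNIV :: (real^'n) set) \<longrightarrow>
            2 \<le> q \<and> s \<ge> s_crit CARD('n) q)
       \<and> (max_estimate \<sigma> q s UNIV (UNIV :: (real^'n) set) \<longrightarrow>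
            q_crit CARD('n) \<le> q \<and> s \<ge> real CARD('n) * (1/2 - inv_exp q))
       \<and> ((max_estimate \<sigma> q s {0<..<1} (ball (0 :: real^'n) 1)
            \<or> max_estimate \<sigma> q s UNIV (ball (0 :: real^'n) 1)) \<longrightarrow>
            s \<ge> max (1/2) (s_crit CARD('n) q))"
proof (intro conjI impI)
  note loc = max_estimate_local_necessary[OF _ assms(2,1)]
  {
    assume est: "max_estimate \<sigma> q s {0<..<1} (UNIV :: (real^'n) set)"
    show "2 \<le> q"
      using max_estimate_global_space[OF est assms(2,1)] assms(2)
      by (cases q) (auto simp: inv_exp_def field_simps)
    show "s \<ge> s_crit CARD('n) q"
      using loc[OF est] by simp
  next
    assume est: "max_estimate \<sigma> q s UNIV (UNIV :: (real^'n) set)"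
    show "s \<ge> real CARD('n) * (1/2 - inv_exp q)"
      using loc[OF est] by (simp add: s_crit_def)
    define n where "n = CARD('n)"
    have n: "1 \<le> n" by (simp add: n_def Suc_le_eq)
    \<comment> \<open>Here the frequency stays near \<open>1\<close> while the plate narrows and the
      time grows like \<open>R\<close>, so \<open>s\<close> drops out. Such times are available
      because the supremum and the norm are both global.\<close>
    have le: "(real n + 1) / 2 * inv_exp q \<le> (real n - 1) / 4"
      using max_estimate_exponents[OF est assms(2,1), of 0 "-1/2" 1]
      by (simp add: n_def field_simps)
    have "q_crit n \<le> q"
    proof (cases q)
      case (real p)
      with assms(2) have p: "1 \<le> p" by simp
      with le real have le: "2 * (real n + 1) \<le> p * (real n - 1)"
        by (simp add: inv_exp_def field_simps)
      \<comment> \<open>For \<open>n = 1\<close> the inequality would read \<open>4 \<le> 0\<close>: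
        no finite \<open>q\<close> is possible, in accordance with
        \<open>q_crit 1 = \<infinity>\<close>.\<close>
      have "n \<noteq> 1" using le by auto
      with n have "real n - 1 > 0" by simp
      with le real \<open>n \<noteq> 1\<close> show ?thesis
        by (simp add: q_crit_def divide_le_eq)
    qed (use assms(2) in auto)
    then show "q_crit CARD('n) \<le> q" by (simp add: n_def)
  next
    assume "max_estimate \<sigma> q s {0<..<1} (ball (0 :: real^'n) 1) \<or> max_estimate \<sigma> q s UNIV (ball (0 :: real^'n) 1)"
    then show "s \<ge> max (1/2) (s_crit CARD('n) q)"
      using loc by blast
  }
qed

end
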